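(* Let $r\ge2$. The Hamming code $H_r$ is a $(2^r-1)$-graphical design on $Q_{2^r-1}$, but only a classical $t$-design in the Hamming scheme on $\{0,1\}^{2^r-1}$ for $t=2^{r-1}-1$; that is, $H_r$ is a $t$-design for $t=2^{r-1}-1$ and is not a $t$-design for any larger $t \le 2^r-1$.
   Context: $Q_d$ is the graph with vertex set $\{0,1\}^d$ in which two vertices are adjacent iff they differ in exactly one coordinate. For a graph $G=(V,E)$ with adjacency matrix $A$ and diagonal degree matrix $D$, $L=AD^{-1}-I$. A nonempty $W\subset V$ integrates $\phi:V\to\mathbb{R}$ if $\frac{1}{|W|}\sum_{w\in W}\phi(w)=\frac{1}{|V|}\sum_{v\in V}\phi(v)$, and integrates an eigenspace of $L$ if it integrates every eigenvector in a basis of it. For $Q_d$, the eigenspaces of $L$ are $\Lambda_i=\operatorname{span}\{\phi_v: v \text{ has exactly } i \text{ ones}\}$, $i=0,\dots,d$, where $\phi_v(x)=(-1)^{v^Tx}$, with eigenvalue $\lambda=-2i/d$. A frequency ordering lists the eigenspaces in order of nonincreasing $|\lambda+1|$, with $\Lambda_0$ first; eigenspaces with equal $|\lambda+1|$ (namely $\Lambda_i$ and $\Lambda_{d-i}$) are interchangeable. $W$ is a $k$-graphical design if it integrates the first $k$ eigenspaces in some frequency ordering. The Hamming scheme on $X=\{0,1\}^d$ is the association scheme with relations $R_i=\{(x,y): x \text{ and } y \text{ differ in exactly } i \text{ coordinates}\}$, $i=0,\ldots,d$. Its primitive idempotents, in the cometric ordering used, are $J_0,\ldots,J_d$ with $J_i$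 the orthogonal projection of $\mathbb{R}^X$ onto $\Lambda_i$. A subset $Y\subset X$ is a (classical) $t$-design if $J_i\mathbf{1}_Y=0$ for all $i\in\{1,\ldots,t\}$, where $\mathbf{1}_Y$ is the indicator vector of $Y$. The Hamming code $H_r$ is $\{x\in\{0,1\}^{2^r-1}: M_rx=0\text{ mod }2\}$, where $M_r$ is the $r\times(2^r-1)$ matrix whose columns are the nonzero vectors of $\{0,1\}^r$. *)

theory Defs
  imports
    Jordan_Normal_Form.Matrix
    "HOL-Library.Z2"
    "HOL-Library.Function_Algebras"
    Complex_Main
begin

section \<open>Real-valued functions as vectors\<close>

instantiation "fun" :: (type, real_vector) real_vector
begin

definition scaleR_fun_def: "scaleR c f = (\<lambda>x. c *\<^sub>R f x)"

instance
  by standard (auto simp: scaleR_fun_def fun_eq_iff scaleR_add_right scaleR_add_left)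

end

text \<open>The space of real functions on a set \<open>V\<close> is represented by the functions that vanish
  outside \<open>V\<close>, so that equality, \<^const>\<open>span\<close> and \<^const>\<open>independent\<close> have
  their usual meaning.\<close>

definition functions_on :: "'v set \<Rightarrow> ('v \<Rightarrow> real) set" where
  "functions_on V = {f. \<forall>x. x \<notin> V \<longrightarrow> f x = 0}"

section \<open>Graphical designs\<close>

text \<open>A graph is given by its vertex set \<open>V\<close> and its adjacency relation \<open>E\<close>; matrices
  with rows and columns indexed by \<open>V\<close> are binary functions.\<close>

definition degree_in :: "'v set \<Rightarrow> ('v \<Rightarrow> 'v \<Rightarrow> bool) \<Rightarrow> 'v \<Rightarrow> nat" where
  "degree_in V E x = card {y \<in> V. E x y}"

text \<open>The entry of \<open>A D\<^sup>-\<^sup>1 - I\<close> at \<open>(x, y)\<close>; as \<open>D\<close> is diagonal,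
  \<open>(A D\<^sup>-\<^sup>1)(x, y) = A(x, y) / D(y, y)\<close>.\<close>

definition laplacian :: "'v set \<Rightarrow> ('v \<Rightarrow> 'v \<Rightarrow> bool) \<Rightarrow> 'v \<Rightarrow> 'v \<Rightarrow> real" where
  "laplacian V E x y = of_bool (E x y) / real (degree_in V E y) - of_bool (x = y)"

definition eigenspace :: "'v set \<Rightarrow> ('v \<Rightarrow> 'v \<Rightarrow> bool) \<Rightarrow> real \<Rightarrow> ('v \<Rightarrow> real) set" where
  "eigenspace V E l =
    {f \<in> functions_on V. \<forall>x\<in>V. (\<Sum>y\<in>V. laplacian V E x y * f y) = l * f x}"

definition eigenvalues :: "'v set \<Rightarrow> ('v \<Rightarrow> 'v \<Rightarrow> bool) \<Rightarrow> real set" where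
  "eigenvalues V E = {l. \<exists>f \<in> eigenspace V E l. f \<noteq> 0}"

definition integrates :: "'v set \<Rightarrow> 'v set \<Rightarrow> ('v \<Rightarrow> real) \<Rightarrow> bool" where
  "integrates V W f \<longleftrightarrow> W \<noteq> {} \<and> W \<subseteq> V \<and>
    (\<Sum>w\<in>W. f w) / real (card W) = (\<Sum>v\<in>V. f v) / real (card V)"

definition integrates_eigenspace ::
    "'v set \<Rightarrow> ('v \<Rightarrow> 'v \<Rightarrow> bool) \<Rightarrow> 'v set \<Rightarrow> real \<Rightarrow> bool" where
  "integrates_eigenspace V E W l \<longleftrightarrow>
    (\<exists>B. independent B \<and> span B = eigenspace V E l \<and> (\<forall>f\<in>B. integrates V W f))"

text \<open>An ordering of the eigenspaces is represented by the list of the corresponding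
  eigenvalues. The distinguished first eigenspace is the one for eigenvalue \<open>0\<close>.\<close>

definition frequency_ordering :: "'v set \<Rightarrow> ('v \<Rightarrow> 'v \<Rightarrow> bool) \<Rightarrow> real list \<Rightarrow> bool" where
  "frequency_ordering V E ls \<longleftrightarrow>
    distinct ls \<and> set ls = eigenvalues V E \<and> ls \<noteq> [] \<and> hd ls = 0 \<and>
    sorted_wrt (\<lambda>l m. \<bar>l + 1\<bar> \<ge> \<bar>m + 1\<bar>) ls"

definition graphical_design ::
    "'v set \<Rightarrow> ('v \<Rightarrow> 'v \<Rightarrow> bool) \<Rightarrow> nat \<Rightarrow> 'v set \<Rightarrow> bool" where
  "graphical_design V E k W \<longleftrightarrow> W \<noteq> {} \<and> W \<subseteq> V \<and>
    (\<exists>ls. frequency_ordering V E ls \<and> k \<le> length ls \<and>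
      (\<forall>l \<in> set (take k ls). integrates_eigenspace V E W l))"

section \<open>The cube and the Hamming scheme\<close>

text \<open>\<open>{0,1}\<^sup>d\<close> is \<open>carrier_vec d\<close> over the field \<^typ>\<open>bit\<close>, so arithmetic on
  its elements is arithmetic modulo 2.\<close>

abbreviation cube :: "nat \<Rightarrow> bit vec set" where
  "cube d \<equiv> carrier_vec d"

definition cube_adj :: "nat \<Rightarrow> bit vec \<Rightarrow> bit vec \<Rightarrow> bool" where
  "cube_adj d x y \<longleftrightarrow> x \<in> cube d \<and> y \<in> cube d \<and> card {i. i < d \<and> x $ i \<noteq> y $ i} = 1"

text \<open>\<open>\<phi>\<^sub>v(x) = (-1)\<close> to the power \<open>v\<^sup>T x\<close>; only the parity of \<open>v\<^sup>T x\<close> matters, which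
  is the scalar product over \<^typ>\<open>bit\<close>.\<close>

definition character :: "nat \<Rightarrow> bit vec \<Rightarrow> bit vec \<Rightarrow> real" where
  "character d v x = (if x \<in> cube d then (if v \<bullet> x = 0 then 1 else - 1) else 0)"

definition char_space :: "nat \<Rightarrow> nat \<Rightarrow> (bit vec \<Rightarrow> real) set" where
  "char_space d i = span {character d v | v. v \<in> cube d \<and> card {j. j < d \<and> v $ j = 1} = i}"

definition orthogonal_projection :: "'v set \<Rightarrow> ('v \<Rightarrow> real) set \<Rightarrow> ('v \<Rightarrow> real) \<Rightarrow> 'v \<Rightarrow> real" where
  "orthogonal_projection X U f =
    (THE g. g \<in> U \<and> (\<forall>h\<in>U. (\<Sum>x\<in>X. (f x - g x) * h x) = 0))"

text \<open>The primitive idempotents \<open>J\<^sub>i\<close> of the Hamming scheme on \<open>{0,1}\<^sup>d\<close>, as operators.\<close>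

definition hamming_idempotent :: "nat \<Rightarrow> nat \<Rightarrow> (bit vec \<Rightarrow> real) \<Rightarrow> bit vec \<Rightarrow> real" where
  "hamming_idempotent d i = orthogonal_projection (cube d) (char_space d i)"

definition classical_design :: "nat \<Rightarrow> nat \<Rightarrow> bit vec set \<Rightarrow> bool" where
  "classical_design d t Y \<longleftrightarrow> Y \<subseteq> cube d \<and>
    (\<forall>i\<in>{1..t}. hamming_idempotent d i (\<lambda>x. of_bool (x \<in> Y)) = 0)"

section \<open>Hamming codes\<close>

text \<open>The order of the columns of \<open>M\<^sub>r\<close> is arbitrary.\<close>

definition hamming_matrix :: "nat \<Rightarrow> bit mat \<Rightarrow> bool" where
  "hamming_matrix r M \<longleftrightarrow> M \<in> carrier_mat r (2 ^ r - 1) \<and>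
    distinct (cols M) \<and> set (cols M) = carrier_vec r - {0\<^sub>v r}"

definition hamming_code :: "nat \<Rightarrow> bit mat \<Rightarrow> bit vec set" where
  "hamming_code r M = {x \<in> cube (2 ^ r - 1). M *\<^sub>v x = 0\<^sub>v r}"

end

theory Submission
  imports Defs
begin

text \<open>Put \<open>d = 2\<^sup>r - 1\<close> and \<open>h = 2\<^sup>r\<^sup>-\<^sup>1\<close>, so that \<open>d + 1 = 2h\<close>. Both kinds of design are
  conditions on the sums of the characters \<open>\<phi>\<^sub>v\<close> over the code, and for a linear code these sums
  see only the dual code: if some codeword \<open>u\<close> has \<open>v\<^sup>T u = 1\<close>, translation by \<open>u\<close> permutes the code
  and flips the sign of \<open>\<phi>\<^sub>v\<close>, so the sum vanishes; otherwise \<open>\<phi>\<^sub>v = 1\<close> on the code and the sum is the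
  size of the code.

  The coordinates of the cube are indexed by the nonzero vectors of \<open>{0,1}\<^sup>r\<close>, the columns of the
  matrix. For distinct columns \<open>a\<close>, \<open>b\<close> the word supported on \<open>a\<close>, \<open>b\<close>, \<open>a + b\<close> is a codeword, so a
  dual vector, read as a function on columns and extended by \<open>0\<close> at the zero vector, is additive. A
  nonzero additive function takes the value \<open>1\<close> on exactly half of \<open>{0,1}\<^sup>r\<close>; hence every nonzero dual
  vector has weight \<open>h\<close> (\<open>dual_codeword_weight\<close>). Dual vectors of weight \<open>h\<close> exist: the first row of
  the matrix is one (\<open>ex_dual_codeword\<close>). So among the spaces \<open>\<Lambda>\<^sub>1, \<dots>, \<Lambda>\<^sub>d\<close> the code fails on \<open>\<Lambda>\<^sub>h\<close> and
  on no other.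

  In the cometric ordering this space is met at position \<open>h\<close>, which makes \<open>h - 1\<close> the classical
  strength. In the frequency ordering it can be put last: \<open>|\<lambda> + 1| = |d - 2i| / d\<close> for \<open>\<Lambda>\<^sub>i\<close>, and as
  \<open>d\<close> is odd the value \<open>1 / d\<close> at \<open>i = h\<close> is the minimum. The \<open>d\<close> spaces before it are all integrated.

  The link between the definitions and character sums is Fourier analysis on the cube. Fourier
  inversion and the symmetry of the Laplacian show that the eigenspace for \<open>-2i/d\<close> lies in \<open>\<Lambda>\<^sub>i\<close> and
  that there are no further eigenvalues; orthogonality of the characters gives the projection
  onto \<open>\<Lambda>\<^sub>i\<close> explicitly.\<close>

section \<open>Vectors over the two-element field\<close>

abbreviation weight :: "nat \<Rightarrow> bit vec \<Rightarrow> nat" where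
  "weight d v \<equiv> card {j. j < d \<and> v $ j = 1}"

lemma bit_add_self: "b + b = (0 :: bit)"
  by (cases b) simp_all

lemma finite_cube: "finite (cube d)"
proof -
  have "finite (UNIV :: bit set)"
    by (rule finite_subset[of _ "{0, 1}"]) auto
  then have "finite (vec d ` (PiE {..<d} (\<lambda>_. UNIV)) :: bit vec set)"
    by (intro finite_imageI finite_PiE) auto
  moreover have "cube d \<subseteq> vec d ` (PiE {..<d} (\<lambda>_. UNIV))"
  proof
    fix x :: "bit vec" assume x: "x \<in> cube d"
    then have "x = vec d (restrict (($) x) {..<d})"
      by (auto intro!: eq_vecI)
    then show "x \<in> vec d ` (PiE {..<d} (\<lambda>_. UNIV))"
      by (rule image_eqI[where f = "vec d"]) auto
  qed
  ultimately show ?thesis by (rule rev_finite_subset)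
qed

lemma cube_add_self: "x \<in> cube d \<Longrightarrow> x + x = 0\<^sub>v d"
  by (intro eq_vecI) (auto simp: bit_add_self)

lemma cube_add_cancel: "x \<in> cube d \<Longrightarrow> y \<in> cube d \<Longrightarrow> x + y + y = x"
  by (intro eq_vecI) (auto simp: add.assoc bit_add_self)

lemma cube_add_eq_0_iff: "x \<in> cube d \<Longrightarrow> y \<in> cube d \<Longrightarrow> x + y = 0\<^sub>v d \<longleftrightarrow> x = y"
  by (metis cube_add_cancel cube_add_self left_zero_vec)

lemma weight_eq_0_iff: "v \<in> cube d \<Longrightarrow> weight d v = 0 \<longleftrightarrow> v = 0\<^sub>v d"
  by (auto intro!: eq_vecI)

lemma weight_le: "weight d v \<le> d"
  using card_mono[of "{..<d}" "{j. j < d \<and> v $ j = 1}"] by auto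

lemma ex_weight:
  assumes "i \<le> d"
  shows "\<exists>v \<in> cube d. weight d v = i"
proof -
  have "{j. j < d \<and> vec d (\<lambda>j. of_bool (j < i) :: bit) $ j = 1} = {..<i}"
    using assms by auto
  then show ?thesis
    by (intro bexI[of _ "vec d (\<lambda>j. of_bool (j < i))"]) auto
qed

section \<open>Characters of the cube\<close>

lemma character_add:
  assumes "v \<in> cube d" "x \<in> cube d" "y \<in> cube d"
  shows "character d v (x + y) = character d v x * character d v y"
  using assms by (cases "v \<bullet> x"; cases "v \<bullet> y")
    (auto simp: character_def scalar_prod_add_distrib[of _ d])

lemma character_commute:
  "v \<in> cube d \<Longrightarrow> x \<in> cube d \<Longrightarrow> character d v x = character d x v"
  by (simp add: character_def comm_scalar_prod[of _ d])

lemma character_unit_vec: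
  assumes "v \<in> cube d" "i < d"
  shows "character d v (unit_vec d i) = (if v $ i = 1 then - 1 else 1)"
  using assms by (cases "v $ i") (auto simp: character_def)

lemma character_in_functions_on: "character d v \<in> functions_on (cube d)"
  by (simp add: functions_on_def character_def)

lemma character_nonzero: "v \<in> cube d \<Longrightarrow> character d v \<noteq> 0"
  by (auto simp: fun_eq_iff character_def intro!: exI[of _ "0\<^sub>v d"])

text \<open>Translation by \<open>u\<close> is an involution of \<open>W\<close> that negates the character, so the sum equals its
  own negative.\<close>

lemma sum_character_translation_invariant:
  assumes "W \<subseteq> cube d" "\<And>x. x \<in> W \<Longrightarrow> x + u \<in> W"
    and "u \<in> cube d" "v \<in> cube d" "v \<bullet> u = 1"
  shows "(\<Sum>w\<in>W. character d v w) = 0"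
proof -
  have "(\<Sum>w\<in>W. character d v w) = (\<Sum>w\<in>W. character d v (w + u))"
    by (rule sum.reindex_bij_witness[of _ "\<lambda>w. w + u" "\<lambda>w. w + u"])
      (use assms cube_add_cancel in auto)
  also have "\<dots> = (\<Sum>w\<in>W. - character d v w)"
  proof (rule sum.cong)
    fix w assume "w \<in> W"
    then show "character d v (w + u) = - character d v w"
      using assms character_add[of v d w u] by (auto simp: character_def)
  qed simp
  finally show ?thesis by (simp add: sum_negf)
qed

lemma sum_character_cube:
  assumes "v \<in> cube d" "v \<noteq> 0\<^sub>v d"
  shows "(\<Sum>x\<in>cube d. character d v x) = 0"
proof -
  obtain j where "j < d" "v $ j = 1"
    using assms weight_eq_0_iff[of v d] by force
  then show ?thesis
    using assms by (intro sum_character_translation_invariant[where u = "unit_vec d j"]) auto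
qed

text \<open>Since \<open>\<phi>\<^sub>v(x) = \<phi>\<^sub>x(v)\<close>, the product of the two values is \<open>\<phi>\<^sub>x\<^sub>+\<^sub>y(v)\<close>, and the sum over \<open>v\<close> is a
  character sum over the whole cube. This is the kernel of Fourier inversion below.\<close>

lemma sum_over_frequencies:
  assumes "x \<in> cube d" "y \<in> cube d"
  shows "(\<Sum>v\<in>cube d. character d v x * character d v y) = real (card (cube d)) * of_bool (x = y)"
proof -
  have "(\<Sum>v\<in>cube d. character d v x * character d v y) = (\<Sum>v\<in>cube d. character d (x + y) v)"
    using assms by (intro sum.cong refl) (simp add: character_commute flip: character_add)
  also have "\<dots> = real (card (cube d)) * of_bool (x = y)"
  proof (cases "x = y")
    case True
    have "(\<Sum>v\<in>cube d. character d (x + y) v) = (\<Sum>v\<in>cube d. 1)"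
      using assms True by (intro sum.cong refl) (simp add: cube_add_self character_def)
    then show ?thesis using True by simp
  next
    case False
    then show ?thesis using assms by (simp add: sum_character_cube cube_add_eq_0_iff)
  qed
  finally show ?thesis .
qed

lemma card_cube_pos: "card (cube d) > 0"
  using zero_carrier_vec[of d] finite_cube by (auto simp: card_gt_0_iff simp del: zero_carrier_vec)

definition fourier_coeff :: "nat \<Rightarrow> (bit vec \<Rightarrow> real) \<Rightarrow> bit vec \<Rightarrow> real" where
  "fourier_coeff d f v = (\<Sum>x\<in>cube d. f x * character d v x) / real (card (cube d))"

lemma sum_fun_apply: "(\<Sum>a\<in>A. g a) x = (\<Sum>a\<in>A. g a x)"
  by (induction A rule: infinite_finite_induct) auto

text \<open>Inversion shows that the characters span all functions on the cube, so the spectrum can be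
  found without counting dimensions.\<close>

lemma fourier_inversion:
  assumes "f \<in> functions_on (cube d)"
  shows "f = (\<Sum>v\<in>cube d. fourier_coeff d f v *\<^sub>R character d v)"
proof
  fix y
  show "f y = (\<Sum>v\<in>cube d. fourier_coeff d f v *\<^sub>R character d v) y"
  proof (cases "y \<in> cube d")
    case False
    then show ?thesis using assms
      by (simp add: sum_fun_apply scaleR_fun_def character_def functions_on_def)
  next
    case True
    have "(\<Sum>v\<in>cube d. fourier_coeff d f v * character d v y) =
      (\<Sum>v\<in>cube d. \<Sum>x\<in>cube d. f x * (character d v x * character d v y) / real (card (cube d)))"
      by (simp add: fourier_coeff_def sum_distrib_right sum_divide_distrib mult.assoc)
    also have "\<dots> = (\<Sum>x\<in>cube d. f x *
        (\<Sum>v\<in>cube d. character d v x * character d v y) / real (card (cube d)))"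
      by (subst sum.swap) (simp add: sum_distrib_left sum_divide_distrib)
    also have "\<dots> = (\<Sum>x\<in>cube d. if x = y then f x else 0)"
      using True card_cube_pos[of d] by (intro sum.cong) (auto simp: sum_over_frequencies)
    also have "\<dots> = f y" using True finite_cube by simp
    finally show ?thesis by (simp add: sum_fun_apply scaleR_fun_def)
  qed
qed

lemma span_functions_on: "S \<subseteq> functions_on V \<Longrightarrow> span S \<subseteq> functions_on V"
  by (rule span_minimal) (auto simp: subspace_def functions_on_def scaleR_fun_def)

lemma char_space_subset_functions_on: "char_space d i \<subseteq> functions_on (cube d)"
  unfolding char_space_def by (rule span_functions_on) (auto simp: character_in_functions_on)

lemma linear_sum_over: "linear (\<lambda>f. \<Sum>x\<in>X. f x * (c x :: real) :: real)"
  by (rule linearI) (auto simp: scaleR_fun_def sum.distrib sum_distrib_left algebra_simps)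

lemma character_in_char_space:
  "v \<in> cube d \<Longrightarrow> weight d v = i \<Longrightarrow> character d v \<in> char_space d i"
  unfolding char_space_def by (rule span_base) auto

text \<open>All conditions on \<open>\<Lambda>\<^sub>i\<close> below (integration, orthogonality) are the vanishing of linear
  functionals, and so need to be tested only on the characters.\<close>

lemma linear_zero_on_char_space:
  assumes "linear (F :: _ \<Rightarrow> real)" "f \<in> char_space d i"
    and "\<And>v. v \<in> cube d \<Longrightarrow> weight d v = i \<Longrightarrow> F (character d v) = 0"
  shows "F f = 0"
proof (rule linear_eq_0_on_span[OF assms(1) _ assms(2)[unfolded char_space_def]])
  fix g assume "g \<in> {character d v | v. v \<in> cube d \<and> weight d v = i}"
  then show "F g = 0" using assms(3) by blast
qed

lemma character_orthogonality:
  assumes "v \<in> cube d" "w \<in> cube d"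
  shows "(\<Sum>x\<in>cube d. character d v x * character d w x) = real (card (cube d)) * of_bool (v = w)"
proof -
  have "(\<Sum>x\<in>cube d. character d v x * character d w x) =
      (\<Sum>x\<in>cube d. character d x v * character d x w)"
    using assms by (intro sum.cong refl) (simp add: character_commute)
  then show ?thesis using assms by (simp add: sum_over_frequencies)
qed

section \<open>Spectrum of the cube\<close>

lemma neighbours_eq_unit_translates:
  "{y \<in> cube d. cube_adj d x y} = (if x \<in> cube d then (\<lambda>i. x + unit_vec d i) ` {..<d} else {})"
proof (cases "x \<in> cube d")
  case x: True
  have "{y \<in> cube d. cube_adj d x y} = (\<lambda>i. x + unit_vec d i) ` {..<d}"
  proof (intro equalityI subsetI)
    fix y assume "y \<in> {y \<in> cube d. cube_adj d x y}"
    then have y: "y \<in> cube d" and one: "card {i. i < d \<and> x $ i \<noteq> y $ i} = 1"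
      by (auto simp: cube_adj_def)
    from one obtain i where i: "{i. i < d \<and> x $ i \<noteq> y $ i} = {i}"
      by (rule card_1_singletonE)
    then have "i < d" by auto
    moreover have "y = x + unit_vec d i"
    proof (rule eq_vecI)
      fix j assume "j < dim_vec (x + unit_vec d i)"
      then have "j < d" by simp
      moreover have "(j < d \<and> x $ j \<noteq> y $ j) = (j = i)" using i by auto
      ultimately show "y $ j = (x + unit_vec d i) $ j"
        using x y by (cases "x $ j"; cases "y $ j") (auto simp: unit_vec_def)
    qed (use x y in auto)
    ultimately show "y \<in> (\<lambda>i. x + unit_vec d i) ` {..<d}" by auto
  next
    fix y assume "y \<in> (\<lambda>i. x + unit_vec d i) ` {..<d}"
    then obtain i where i: "i < d" "y = x + unit_vec d i" by auto
    have "x $ j \<noteq> y $ j \<longleftrightarrow> j = i" if "j < d" for j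
      using x i that by (cases "x $ j") (auto simp: unit_vec_def)
    then have "{j. j < d \<and> x $ j \<noteq> y $ j} = {i}"
      using i(1) by blast
    then show "y \<in> {y \<in> cube d. cube_adj d x y}"
      using x i by (auto simp: cube_adj_def)
  qed
  then show ?thesis using x by simp
qed (auto simp: cube_adj_def)

lemma inj_unit_translate: "x \<in> cube d \<Longrightarrow> inj_on (\<lambda>i. x + unit_vec d i :: bit vec) {..<d}"
proof (rule inj_onI)
  fix i j assume x: "x \<in> cube d" and ij: "i \<in> {..<d}" "j \<in> {..<d}"
    and "x + unit_vec d i = x + unit_vec d j"
  then have "(x + unit_vec d i) $ i = (x + unit_vec d j) $ i" by simp
  then show "i = j" using x ij by (cases "x $ i") (auto simp: unit_vec_def split: if_splits)
qed

lemma degree_in_cube: "x \<in> cube d \<Longrightarrow> degree_in (cube d) (cube_adj d) x = d"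
  by (simp add: degree_in_def neighbours_eq_unit_translates card_image inj_unit_translate)

lemma sum_adjacent:
  assumes "x \<in> cube d"
  shows "(\<Sum>y\<in>cube d. of_bool (cube_adj d x y) * (h y :: real)) = (\<Sum>i<d. h (x + unit_vec d i))"
proof -
  have "(\<Sum>y\<in>cube d. of_bool (cube_adj d x y) * h y) = (\<Sum>y\<in>{y \<in> cube d. cube_adj d x y}. h y)"
    using finite_cube by (intro sum.mono_neutral_cong_right) auto
  also have "\<dots> = (\<Sum>i<d. h (x + unit_vec d i))"
    using assms by (simp add: neighbours_eq_unit_translates sum.reindex inj_unit_translate)
  finally show ?thesis .
qed

definition cube_eigenvalue :: "nat \<Rightarrow> nat \<Rightarrow> real" where
  "cube_eigenvalue d i = - 2 * real i / real d"

text \<open>A step in direction \<open>i\<close> multiplies \<open>\<phi>\<^sub>v\<close> by \<open>-1\<close> if \<open>v\<^sub>i = 1\<close> and by \<open>1\<close> otherwise, so the average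
  over the \<open>d\<close> neighbours of \<open>x\<close> is \<open>(d - 2|v|) / d\<close> times \<open>\<phi>\<^sub>v(x)\<close>.\<close>

lemma laplacian_character:
  assumes "d > 0" "v \<in> cube d" "x \<in> cube d"
  shows "(\<Sum>y\<in>cube d. laplacian (cube d) (cube_adj d) x y * character d v y) =
    cube_eigenvalue d (weight d v) * character d v x"
proof -
  have "(\<Sum>y\<in>cube d. laplacian (cube d) (cube_adj d) x y * character d v y) =
    (\<Sum>y\<in>cube d. of_bool (cube_adj d x y) * character d v y / real d
      - (if x = y then character d v y else 0))"
    by (intro sum.cong) (auto simp: laplacian_def degree_in_cube algebra_simps)
  also have "\<dots> = (\<Sum>y\<in>cube d. of_bool (cube_adj d x y) * character d v y) / real d
      - character d v x"
    using assms finite_cube by (simp add: sum_subtractf flip: sum_divide_distrib)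
  also have "(\<Sum>y\<in>cube d. of_bool (cube_adj d x y) * character d v y)
      = (\<Sum>i<d. character d v x * (if v $ i = 1 then - 1 else 1))"
    unfolding sum_adjacent[OF assms(3)]
    using assms by (intro sum.cong) (auto simp: character_add character_unit_vec)
  also have "\<dots> = character d v x * (\<Sum>i<d. 1 - 2 * of_bool (v $ i = 1))"
    unfolding sum_distrib_left by (intro sum.cong) auto
  also have "(\<Sum>i<d. 1 - 2 * of_bool (v $ i = 1)) = real d - 2 * (\<Sum>i<d. of_bool (v $ i = 1))"
    by (simp add: sum_subtractf sum_distrib_left)
  also have "(\<Sum>i<d. of_bool (v $ i = 1) :: real) = real (weight d v)"
  proof -
    have "{..<d} \<inter> {i. v $ i = 1} = {j. j < d \<and> v $ j = 1}" by auto
    then show ?thesis by (simp add: of_bool_def sum.If_cases)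
  qed
  finally show ?thesis using assms(1) by (simp add: cube_eigenvalue_def field_simps)
qed

lemma laplacian_cube_sym:
  "x \<in> cube d \<Longrightarrow> y \<in> cube d \<Longrightarrow>
    laplacian (cube d) (cube_adj d) x y = laplacian (cube d) (cube_adj d) y x"
  by (simp add: laplacian_def degree_in_cube cube_adj_def eq_commute)

text \<open>Eigenvectors of a symmetric operator for different eigenvalues are orthogonal.\<close>

lemma fourier_coeff_eigenvector:
  assumes "d > 0" "f \<in> eigenspace (cube d) (cube_adj d) l"
    and "v \<in> cube d" "l \<noteq> cube_eigenvalue d (weight d v)"
  shows "fourier_coeff d f v = 0"
proof -
  let ?L = "laplacian (cube d) (cube_adj d)"
  let ?s = "\<Sum>x\<in>cube d. f x * character d v x"
  have "l * ?s = (\<Sum>x\<in>cube d. (\<Sum>y\<in>cube d. ?L x y * f y) * character d v x)"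
    using assms(2) by (simp add: eigenspace_def sum_distrib_left mult.assoc)
  also have "\<dots> = (\<Sum>y\<in>cube d. f y * (\<Sum>x\<in>cube d. ?L y x * character d v x))"
    unfolding sum_distrib_left sum_distrib_right
    by (subst sum.swap) (auto intro!: sum.cong simp: laplacian_cube_sym)
  also have "\<dots> = (\<Sum>y\<in>cube d. f y * (cube_eigenvalue d (weight d v) * character d v y))"
    using assms by (intro sum.cong) (simp_all add: laplacian_character)
  also have "\<dots> = cube_eigenvalue d (weight d v) * ?s"
    unfolding sum_distrib_left by (simp add: mult_ac)
  finally show ?thesis using assms(4) by (simp add: fourier_coeff_def)
qed

lemma cube_eigenvalue_eq_iff: "d > 0 \<Longrightarrow> cube_eigenvalue d i = cube_eigenvalue d j \<longleftrightarrow> i = j"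
  by (simp add: cube_eigenvalue_def)

lemma eigenspace_cube_subset:
  assumes "d > 0"
  shows "eigenspace (cube d) (cube_adj d) (cube_eigenvalue d i) \<subseteq> char_space d i"
proof
  fix f assume f: "f \<in> eigenspace (cube d) (cube_adj d) (cube_eigenvalue d i)"
  have "(\<Sum>v\<in>cube d. fourier_coeff d f v *\<^sub>R character d v) \<in> char_space d i"
  proof -
    have "fourier_coeff d f v *\<^sub>R character d v \<in> char_space d i" if v: "v \<in> cube d" for v
    proof (cases "weight d v = i")
      case True
      then show ?thesis using v character_in_char_space[of v d i]
        by (simp add: char_space_def span_scale)
    next
      case False
      then have "fourier_coeff d f v = 0"
        using fourier_coeff_eigenvector[OF assms f v] assms by (simp add: cube_eigenvalue_eq_iff)
      then show ?thesis by (simp add: char_space_def span_zero)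
    qed
    then show ?thesis unfolding char_space_def by (intro span_sum) auto
  qed
  moreover have "f \<in> functions_on (cube d)" using f by (simp add: eigenspace_def)
  ultimately show "f \<in> char_space d i" using fourier_inversion by metis
qed

lemma eigenvalues_cube:
  assumes "d > 0"
  shows "eigenvalues (cube d) (cube_adj d) = cube_eigenvalue d ` {..d}"
proof (intro equalityI subsetI)
  fix l assume "l \<in> eigenvalues (cube d) (cube_adj d)"
  then obtain f where f: "f \<in> eigenspace (cube d) (cube_adj d) l" "f \<noteq> 0"
    by (auto simp: eigenvalues_def)
  have "\<exists>v\<in>cube d. l = cube_eigenvalue d (weight d v)"
  proof (rule ccontr)
    assume "\<not> ?thesis"
    then have "(\<Sum>v\<in>cube d. fourier_coeff d f v *\<^sub>R character d v) = 0"
      using fourier_coeff_eigenvector[OF assms f(1)] by (intro sum.neutral) auto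
    moreover have "f \<in> functions_on (cube d)" using f by (simp add: eigenspace_def)
    ultimately show False using fourier_inversion f(2) by metis
  qed
  then show "l \<in> cube_eigenvalue d ` {..d}" using weight_le by blast
next
  fix l assume "l \<in> cube_eigenvalue d ` {..d}"
  then obtain v where v: "v \<in> cube d" "l = cube_eigenvalue d (weight d v)"
    using ex_weight[of _ d] by auto
  then have "character d v \<in> eigenspace (cube d) (cube_adj d) l"
    using assms by (simp add: eigenspace_def character_in_functions_on laplacian_character)
  then show "l \<in> eigenvalues (cube d) (cube_adj d)"
    using character_nonzero[OF v(1)] by (auto simp: eigenvalues_def)
qed

lemma subspace_eigenspace: "subspace (eigenspace V E l)"
proof (rule subspaceI)
  fix c :: real and f assume f: "f \<in> eigenspace V E l"
  have "(\<Sum>y\<in>V. laplacian V E x y * (c * f y)) = c * (\<Sum>y\<in>V. laplacian V E x y * f y)" for x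
    by (simp add: sum_distrib_left mult.left_commute)
  then show "c *\<^sub>R f \<in> eigenspace V E l"
    using f by (simp add: eigenspace_def functions_on_def scaleR_fun_def mult.left_commute)
qed (auto simp: eigenspace_def functions_on_def distrib_left sum.distrib)

text \<open>Sorting the remaining eigenvalues by the frequency condition gives an ordering; only the two
  ends are prescribed.\<close>

lemma frequency_ordering_with_last:
  assumes "finite (eigenvalues V E)" "0 \<in> eigenvalues V E" "m \<in> eigenvalues V E" "m \<noteq> 0"
    and "\<And>l. l \<in> eigenvalues V E \<Longrightarrow> \<bar>l + 1\<bar> \<le> 1"
    and "\<And>l. l \<in> eigenvalues V E \<Longrightarrow> \<bar>m + 1\<bar> \<le> \<bar>l + 1\<bar>"
  shows "\<exists>ls. frequency_ordering V E (ls @ [m])"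
proof -
  define us where "us = sort_key (\<lambda>l. - \<bar>l + 1\<bar>) (sorted_list_of_set (eigenvalues V E - {0, m}))"
  have set: "set us = eigenvalues V E - {0, m}" and dist: "distinct us"
    using assms(1) by (auto simp: us_def)
  have "sorted (map (\<lambda>l. - \<bar>l + 1\<bar>) us)" by (simp add: us_def)
  then have "sorted_wrt (\<lambda>l m. \<bar>l + 1\<bar> \<ge> \<bar>m + 1\<bar>) us"
    by (simp add: sorted_wrt_map)
  then have "frequency_ordering V E ((0 # us) @ [m])"
    using assms set dist by (auto simp: frequency_ordering_def sorted_wrt_append)
  then show ?thesis by blast
qed

section \<open>Designs and character sums\<close>

text \<open>The frequency \<open>v = 0\<close> is excluded from the hypothesis because the constant function is
  integrated by every nonempty set; for \<open>v \<noteq> 0\<close> the average over the cube is \<open>0\<close>.\<close>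

lemma integrates_eigenspace_cube:
  assumes "d > 0" "W \<noteq> {}" "W \<subseteq> cube d"
    and "\<And>v. v \<in> cube d \<Longrightarrow> weight d v = i \<Longrightarrow> v \<noteq> 0\<^sub>v d \<Longrightarrow> (\<Sum>w\<in>W. character d v w) = 0"
  shows "integrates_eigenspace (cube d) (cube_adj d) W (cube_eigenvalue d i)"
proof -
  let ?S = "eigenspace (cube d) (cube_adj d) (cube_eigenvalue d i)"
  let ?F = "\<lambda>f. (\<Sum>w\<in>W. f w) / real (card W) - (\<Sum>v\<in>cube d. f v) / real (card (cube d))"
  obtain B where B: "B \<subseteq> ?S" "independent B" "?S \<subseteq> span B"
    by (rule maximal_independent_subset)
  have "span B = ?S"
    using span_minimal[OF B(1) subspace_eigenspace] B(3) by (rule subset_antisym)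
  moreover have "integrates (cube d) W f" if "f \<in> B" for f
  proof -
    have "linear ?F"
      by (rule linearI)
        (simp_all add: scaleR_fun_def sum.distrib add_divide_distrib right_diff_distrib
          flip: sum_distrib_left)
    moreover have "f \<in> char_space d i"
      using that B(1) eigenspace_cube_subset[OF assms(1)] by blast
    moreover have "?F (character d v) = 0" if v: "v \<in> cube d" "weight d v = i" for v
    proof (cases "v = 0\<^sub>v d")
      case True
      have avg: "(\<Sum>x\<in>X. character d (0\<^sub>v d) x) / real (card X) = 1" if "X \<noteq> {}" "X \<subseteq> cube d" for X
      proof -
        have "(\<Sum>x\<in>X. character d (0\<^sub>v d) x) = (\<Sum>x\<in>X. 1)"
          using that by (intro sum.cong) (auto simp: character_def)
        moreover have "finite X" using that finite_cube finite_subset by blast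
        ultimately show ?thesis using that by simp
      qed
      have ne: "cube d \<noteq> {}" using zero_carrier_vec[of d] by blast
      show ?thesis unfolding True avg[OF assms(2,3)] avg[OF ne subset_refl] by (rule diff_self)
    next
      case False
      then show ?thesis using assms(4)[OF v False] sum_character_cube[OF v(1) False] by simp
    qed
    ultimately have "?F f = 0" by (rule linear_zero_on_char_space)
    then show ?thesis using assms(2,3) by (simp add: integrates_def)
  qed
  ultimately show ?thesis using B(2) by (auto simp: integrates_eigenspace_def)
qed

lemma orthogonal_projection_unique:
  assumes "finite X" "subspace U" "U \<subseteq> functions_on X"
    and "g \<in> U" "\<And>h. h \<in> U \<Longrightarrow> (\<Sum>x\<in>X. (f x - g x) * h x) = 0"
  shows "orthogonal_projection X U f = g"
  unfolding orthogonal_projection_def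
proof (rule the_equality)
  show "g \<in> U \<and> (\<forall>h\<in>U. (\<Sum>x\<in>X. (f x - g x) * h x) = 0)"
    using assms(4,5) by blast
next
  fix g' assume g': "g' \<in> U \<and> (\<forall>h\<in>U. (\<Sum>x\<in>X. (f x - g' x) * h x) = 0)"
  have h: "g' - g \<in> U" by (rule subspace_diff[OF assms(2) _ assms(4)]) (rule conjunct1[OF g'])
  have g'_orth: "(\<Sum>x\<in>X. (f x - g' x) * (g' - g) x) = 0"
    using conjunct2[OF g'] h by (rule bspec)
  have "(\<Sum>x\<in>X. (g' x - g x)\<^sup>2) =
      (\<Sum>x\<in>X. (f x - g x) * (g' - g) x - (f x - g' x) * (g' - g) x)"
    by (intro sum.cong refl) (simp add: power2_eq_square algebra_simps)
  also have "\<dots> = 0"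
    unfolding sum_subtractf g'_orth assms(5)[OF h] by simp
  finally have sq: "(\<Sum>x\<in>X. (g' x - g x)\<^sup>2) = 0" .
  have eq: "\<forall>x\<in>X. g' x = g x"
    using sq assms(1) by (simp add: sum_nonneg_eq_0_iff)
  have supp: "g' \<in> functions_on X" "g \<in> functions_on X"
    using conjunct1[OF g'] assms(3,4) by blast+
  show "g' = g"
  proof
    fix x show "g' x = g x"
      using eq supp by (cases "x \<in> X") (simp_all add: functions_on_def)
  qed
qed

text \<open>The projection is \<open>g\<close>, the part of the Fourier expansion of \<open>f\<close> at the frequencies of weight \<open>i\<close>.
  Exhibiting it also shows that the definite description in the definition of the projection
  denotes.\<close>

lemma hamming_idempotent_eq_0_iff:
  "hamming_idempotent d i f = 0 \<longleftrightarrow>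
    (\<forall>v\<in>cube d. weight d v = i \<longrightarrow> (\<Sum>x\<in>cube d. f x * character d v x) = 0)"
proof -
  define U where "U = char_space d i"
  define S where "S = {v \<in> cube d. weight d v = i}"
  define g where "g = (\<Sum>v\<in>S. fourier_coeff d f v *\<^sub>R character d v)"
  have finS: "finite S" using finite_cube by (simp add: S_def)
  have sub: "subspace U" by (simp add: U_def char_space_def)
  have gU: "g \<in> U" unfolding g_def
    using sub by (intro subspace_sum subspace_scale) (auto simp: S_def U_def character_in_char_space)
  have g_coeff: "(\<Sum>x\<in>cube d. g x * character d v x) = (\<Sum>x\<in>cube d. f x * character d v x)"
    if v: "v \<in> S" for v
  proof -
    have "(\<Sum>x\<in>cube d. g x * character d v x) =
      (\<Sum>w\<in>S. fourier_coeff d f w * (\<Sum>x\<in>cube d. character d w x * character d v x))"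
      unfolding g_def sum_fun_apply scaleR_fun_def sum_distrib_left sum_distrib_right
      by (subst sum.swap) (simp add: mult.assoc)
    also have "\<dots> = (\<Sum>w\<in>S. if w = v then fourier_coeff d f w * real (card (cube d)) else 0)"
      using v by (intro sum.cong) (auto simp: S_def character_orthogonality)
    also have "\<dots> = (\<Sum>x\<in>cube d. f x * character d v x)"
      using v finS card_cube_pos[of d] by (simp add: fourier_coeff_def)
    finally show ?thesis .
  qed
  have orth: "(\<Sum>x\<in>cube d. (f x - g x) * h x) = 0" if h: "h \<in> U" for h
  proof -
    have "linear (\<lambda>h. \<Sum>x\<in>cube d. h x * (f x - g x))" by (rule linear_sum_over)
    moreover have "h \<in> char_space d i" using h by (simp only: U_def)
    moreover have "(\<Sum>x\<in>cube d. character d v x * (f x - g x)) = 0"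
      if "v \<in> cube d" "weight d v = i" for v
    proof -
      have "v \<in> S" using that by (simp add: S_def)
      then show ?thesis
        unfolding right_diff_distrib sum_subtractf using g_coeff[of v] by (simp add: mult.commute)
    qed
    ultimately have "(\<Sum>x\<in>cube d. h x * (f x - g x)) = 0"
      by (rule linear_zero_on_char_space)
    then show ?thesis by (simp only: mult.commute)
  qed
  have J: "hamming_idempotent d i f = g"
    unfolding hamming_idempotent_def
    using orthogonal_projection_unique[OF finite_cube sub _ gU orth]
      char_space_subset_functions_on by (simp add: U_def)
  show ?thesis
  proof
    assume "hamming_idempotent d i f = 0"
    then have "g = 0" using J by simp
    then show "\<forall>v\<in>cube d. weight d v = i \<longrightarrow> (\<Sum>x\<in>cube d. f x * character d v x) = 0"
      using g_coeff by (auto simp: S_def)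
  next
    assume "\<forall>v\<in>cube d. weight d v = i \<longrightarrow> (\<Sum>x\<in>cube d. f x * character d v x) = 0"
    then have "g = 0"
      unfolding g_def by (intro sum.neutral) (simp add: S_def fourier_coeff_def)
    then show "hamming_idempotent d i f = 0" using J by simp
  qed
qed

lemma classical_design_iff:
  "classical_design d t Y \<longleftrightarrow> Y \<subseteq> cube d \<and>
    (\<forall>v\<in>cube d. weight d v \<in> {1..t} \<longrightarrow> (\<Sum>y\<in>Y. character d v y) = 0)"
proof (cases "Y \<subseteq> cube d")
  case True
  have Y: "(\<Sum>x\<in>cube d. of_bool (x \<in> Y) * character d v x) = (\<Sum>y\<in>Y. character d v y)" for v
    using True finite_cube by (intro sum.mono_neutral_cong_right) auto
  then show ?thesis
    unfolding classical_design_def hamming_idempotent_eq_0_iff Y by blast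
qed (simp add: classical_design_def)

section \<open>The Hamming code and its dual\<close>

text \<open>Translation by \<open>c\<close> exchanges the two level sets of \<open>f\<close>.\<close>

lemma card_additive_eq_1:
  fixes f :: "bit vec \<Rightarrow> bit"
  assumes add: "\<And>a b. a \<in> cube r \<Longrightarrow> b \<in> cube r \<Longrightarrow> f (a + b) = f a + f b"
    and c: "c \<in> cube r" "f c = 1"
  shows "2 * card {a \<in> cube r. f a = 1} = card (cube r)"
proof -
  have "card {a \<in> cube r. f a = 1} = card {a \<in> cube r. f a = 0}"
    by (rule bij_betw_same_card[of "\<lambda>a. a + c"],
        rule bij_betw_byWitness[where f' = "\<lambda>a. a + c"])
      (use c cube_add_cancel in \<open>auto simp: add\<close>)
  moreover have "card ({a \<in> cube r. f a = 1} \<union> {a \<in> cube r. f a = 0}) =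
      card {a \<in> cube r. f a = 1} + card {a \<in> cube r. f a = 0}"
    using finite_cube[of r] by (intro card_Un_disjoint) auto
  moreover have "{a \<in> cube r. f a = 1} \<union> {a \<in> cube r. f a = 0} = cube r" by auto
  ultimately show ?thesis by simp
qed

lemma mult_unit_vec:
  assumes "M \<in> carrier_mat r d" "i < d"
  shows "M *\<^sub>v unit_vec d i = (col M i :: bit vec)"
  using assms by (intro eq_vecI) auto

lemma hamming_matrix_bij:
  assumes "hamming_matrix r M"
  shows "bij_betw (col M) {..<2 ^ r - 1} (cube r - {0\<^sub>v r})"
proof -
  have dim: "dim_col M = 2 ^ r - 1" using assms by (auto simp: hamming_matrix_def)
  have "bij_betw (\<lambda>j. cols M ! j) {..<length (cols M)} (set (cols M))"
    using assms by (intro bij_betw_nth) (auto simp: hamming_matrix_def)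
  then have "bij_betw (\<lambda>j. cols M ! j) {..<2 ^ r - 1} (cube r - {0\<^sub>v r})"
    using assms dim by (simp add: hamming_matrix_def)
  then show ?thesis
    by (subst bij_betw_cong[of _ _ "\<lambda>j. cols M ! j"]) (auto simp: dim)
qed

lemma card_cube_columns:
  assumes "bij_betw (col M) {..<d} (cube r - {0\<^sub>v r})"
  shows "card (cube r) = d + 1"
proof -
  have "card (cube r - {0\<^sub>v r}) = d"
    using bij_betw_same_card[OF assms] by simp
  moreover have "card (cube r - {0\<^sub>v r}) = card (cube r) - 1"
    by (rule card_Diff_singleton) simp
  ultimately show ?thesis using card_cube_pos[of r] by linarith
qed

text \<open>If the columns of \<open>M\<close> run through the nonzero vectors once each, the support of \<open>v\<close>
  corresponds to the set where \<open>f\<close> takes the value \<open>1\<close>: half of the \<open>d + 1\<close> vectors.\<close>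

lemma weight_additive_on_columns:
  assumes bij: "bij_betw (col M) {..<d} (cube r - {0\<^sub>v r})"
    and v: "v \<in> cube d" "v \<noteq> 0\<^sub>v d"
    and add: "\<And>a b. a \<in> cube r \<Longrightarrow> b \<in> cube r \<Longrightarrow> f (a + b) = f a + f b"
    and f: "\<And>j. j < d \<Longrightarrow> v $ j = f (col M j)"
  shows "2 * weight d v = d + 1"
proof -
  obtain j where j: "j < d" "v $ j = 1"
    using v weight_eq_0_iff[of v d] by force
  have c: "col M j \<in> cube r" using bij_betwE[OF bij] j by blast
  have "f (0\<^sub>v r + 0\<^sub>v r) = f (0\<^sub>v r) + f (0\<^sub>v r)" by (rule add) simp_all
  then have "f (0\<^sub>v r) \<noteq> 1" by (simp add: bit_add_self)
  then have "{a \<in> cube r. f a = 1} = {a \<in> cube r - {0\<^sub>v r}. f a = 1}" by blast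
  also have "\<dots> = {a \<in> col M ` {..<d}. f a = 1}"
    by (simp only: bij_betw_imp_surj_on[OF bij])
  also have "\<dots> = col M ` {j. j < d \<and> v $ j = 1}"
    by (auto simp: f)
  finally have "{a \<in> cube r. f a = 1} = col M ` {j. j < d \<and> v $ j = 1}" .
  moreover have "inj_on (col M) {j. j < d \<and> v $ j = 1}"
    by (rule inj_on_subset[OF bij_betw_imp_inj_on[OF bij]]) auto
  ultimately have "card {a \<in> cube r. f a = 1} = weight d v"
    by (simp only: card_image)
  moreover have "2 * card {a \<in> cube r. f a = 1} = card (cube r)"
  proof (rule card_additive_eq_1)
    show "f (a + b) = f a + f b" if "a \<in> cube r" "b \<in> cube r" for a b
      using that by (rule add)
    show "f (col M j) = 1" using f[OF j(1)] j(2) by (rule trans[OF sym])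
  qed (rule c)
  ultimately show ?thesis unfolding card_cube_columns[OF bij] by (simp only:)
qed

text \<open>The codewords of weight three, supported on distinct columns \<open>a\<close>, \<open>b\<close> and the column \<open>a + b\<close>,
  already force a dual vector to be additive in the column. This replaces the identification of
  the dual code with the row space of \<open>M\<close>.\<close>

lemma dual_codeword_weight:
  assumes M: "M \<in> carrier_mat r d"
    and bij: "bij_betw (col M) {..<d} (cube r - {0\<^sub>v r})"
    and v: "v \<in> cube d" "v \<noteq> 0\<^sub>v d"
    and dual: "\<And>x. x \<in> cube d \<Longrightarrow> M *\<^sub>v x = 0\<^sub>v r \<Longrightarrow> v \<bullet> x = 0"
  shows "2 * weight d v = d + 1"
proof -
  define f where "f a = (if a = 0\<^sub>v r then 0 else v $ inv_into {..<d} (col M) a)" for a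
  have ex_col: "\<exists>i<d. col M i = c" if "c \<in> cube r - {0\<^sub>v r}" for c
  proof -
    have "c \<in> col M ` {..<d}" using that by (simp only: bij_betw_imp_surj_on[OF bij])
    then show ?thesis by blast
  qed
  have f_col: "f (col M j) = v $ j" if "j < d" for j
    using that bij_betwE[OF bij] bij_betw_imp_inj_on[OF bij] by (auto simp: f_def)
  have f_0: "f (0\<^sub>v r) = 0" by (simp add: f_def)
  have add: "f (a + b) = f a + f b" if ab: "a \<in> cube r" "b \<in> cube r" for a b
  proof -
    consider "a = 0\<^sub>v r" | "b = 0\<^sub>v r" | "a = b" | "a \<noteq> 0\<^sub>v r" "b \<noteq> 0\<^sub>v r" "a \<noteq> b" by blast
    then show ?thesis
    proof cases
      case 4
      then have "a + b \<in> cube r - {0\<^sub>v r}" "a \<in> cube r - {0\<^sub>v r}" "b \<in> cube r - {0\<^sub>v r}"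
        using ab cube_add_eq_0_iff[OF ab] by simp_all
      then obtain i j k where ijk: "i < d" "j < d" "k < d"
          and cols: "col M i = a" "col M j = b" "col M k = a + b"
        using ex_col by metis
      let ?x = "unit_vec d i + unit_vec d j + unit_vec d k"
      have "M *\<^sub>v ?x = (a + b) + (a + b)"
        using ijk M cols by (simp add: mult_add_distrib_mat_vec[of M r d] mult_unit_vec[of M r])
      also have "\<dots> = 0\<^sub>v r" using ab by (intro cube_add_self) simp
      finally have "v \<bullet> ?x = 0" by (intro dual) simp_all
      then have "v $ i + v $ j + v $ k = 0"
        using v ijk by (simp add: scalar_prod_add_distrib[of v d])
      then have "f a + f b + f (a + b) = 0"
        by (simp only: f_col[OF ijk(1), unfolded cols(1)] f_col[OF ijk(2), unfolded cols(2)]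
            f_col[OF ijk(3), unfolded cols(3)])
      then show ?thesis by (cases "f a"; cases "f b"; cases "f (a + b)") auto
    qed (use ab f_0 in \<open>auto simp: cube_add_self bit_add_self\<close>)
  qed
  show ?thesis
  proof (rule weight_additive_on_columns[where f = f, OF bij v])
    show "f (a + b) = f a + f b" if "a \<in> cube r" "b \<in> cube r" for a b
      using that by (rule add)
    show "v $ j = f (col M j)" if "j < d" for j
      using f_col[OF that] by (rule sym)
  qed
qed

lemma sum_character_kernel:
  assumes M: "M \<in> carrier_mat r d"
    and bij: "bij_betw (col M) {..<d} (cube r - {0\<^sub>v r})"
    and v: "v \<in> cube d" "v \<noteq> 0\<^sub>v d" "2 * weight d v \<noteq> d + 1"
  shows "(\<Sum>w\<in>{x \<in> cube d. M *\<^sub>v x = 0\<^sub>v r}. character d v w) = 0"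
proof -
  obtain u where u: "u \<in> cube d" "M *\<^sub>v u = 0\<^sub>v r" "v \<bullet> u \<noteq> 0"
    using dual_codeword_weight[OF M bij v(1,2)] v(3) by blast
  show ?thesis
    by (rule sum_character_translation_invariant[OF _ _ u(1) v(1)])
      (use u M in \<open>auto simp: mult_add_distrib_mat_vec[of M r d]\<close>)
qed

text \<open>The first row of \<open>M\<close> is orthogonal to the kernel, and its entry is the first coordinate of the
  column, which is additive and not identically zero.\<close>

lemma ex_dual_codeword:
  assumes M: "M \<in> carrier_mat r d"
    and bij: "bij_betw (col M) {..<d} (cube r - {0\<^sub>v r})" and r: "r > 0"
  shows "\<exists>v\<in>cube d. 2 * weight d v = d + 1 \<and>
    (\<forall>x\<in>cube d. M *\<^sub>v x = 0\<^sub>v r \<longrightarrow> v \<bullet> x = 0)"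
proof -
  have dims: "dim_row M = r" "dim_col M = d" using M by simp_all
  have row: "row M 0 \<in> cube d" by (rule carrier_vecI) (simp add: dims)
  have coords: "row M 0 $ j = col M j $ 0" if "j < d" for j
    using that r by (simp add: dims)
  have "unit_vec r 0 \<in> cube r - {0\<^sub>v r}" using r by simp
  then have "unit_vec r 0 \<in> col M ` {..<d}"
    by (simp only: bij_betw_imp_surj_on[OF bij])
  then obtain j where j: "j < d" "col M j = unit_vec r 0"
    by (metis imageE lessThan_iff)
  have "row M 0 $ j = 1" unfolding coords[OF j(1)] j(2) using r by simp
  then have nz: "row M 0 \<noteq> 0\<^sub>v d" using j(1) by force
  have "2 * weight d (row M 0) = d + 1"
  proof (rule weight_additive_on_columns[where f = "\<lambda>a. a $ 0", OF bij row nz])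
    show "(a + b) $ 0 = a $ 0 + b $ 0" if "a \<in> cube r" "b \<in> cube r" for a b
      using that r by simp
  qed (rule coords)
  moreover have "row M 0 \<bullet> x = 0" if "M *\<^sub>v x = 0\<^sub>v r" for x
  proof -
    have "row M 0 \<bullet> x = (M *\<^sub>v x) $ 0" using r by (simp add: dims)
    then show ?thesis using that r by simp
  qed
  ultimately show ?thesis using row by blast
qed

theorem proposition6p17:
  fixes r :: nat and M :: "bit mat"
  assumes "r \<ge> 2" and "hamming_matrix r M"
  shows "graphical_design (cube (2 ^ r - 1)) (cube_adj (2 ^ r - 1)) (2 ^ r - 1) (hamming_code r M)
    \<and> classical_design (2 ^ r - 1) (2 ^ (r - 1) - 1) (hamming_code r M)
    \<and> (\<forall>t. 2 ^ (r - 1) - 1 < t \<and> t \<le> 2 ^ r - 1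
          \<longrightarrow> \<not> classical_design (2 ^ r - 1) t (hamming_code r M))"
proof -
  define d :: nat where "d = 2 ^ r - 1"
  define h :: nat where "h = 2 ^ (r - 1)"
  define H where "H = hamming_code r M"
  have "(2 :: nat) ^ r = 2 * h" using assms(1) by (cases r) (auto simp: h_def)
  then have d: "d + 1 = 2 * h" and h: "0 < h" by (simp_all add: d_def h_def)
  then have h_d: "h \<le> d" and d_pos: "d > 0" by linarith+
  have M: "M \<in> carrier_mat r d" using assms(2) by (simp add: hamming_matrix_def d_def)
  note bij = hamming_matrix_bij[OF assms(2), folded d_def]
  have H_eq: "H = {x \<in> cube d. M *\<^sub>v x = 0\<^sub>v r}" by (simp add: H_def hamming_code_def d_def)
  have "M *\<^sub>v 0\<^sub>v d = 0\<^sub>v r" using M by (intro eq_vecI) auto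
  then have H: "H \<noteq> {}" "H \<subseteq> cube d" using zero_carrier_vec[of d] unfolding H_eq by blast+
  have chi_sum: "(\<Sum>w\<in>H. character d v w) = 0"
    if "v \<in> cube d" "v \<noteq> 0\<^sub>v d" "weight d v \<noteq> h" for v
    unfolding H_eq using that d by (intro sum_character_kernel[OF M bij]) auto

  have "classical_design d (h - 1) H"
    unfolding classical_design_iff
  proof (intro conjI ballI impI)
    fix v assume v: "v \<in> cube d" "weight d v \<in> {1..h - 1}"
    then have "v \<noteq> 0\<^sub>v d" "weight d v \<noteq> h" using h weight_eq_0_iff[of v d] by fastforce+
    with v(1) show "(\<Sum>y\<in>H. character d v y) = 0" by (rule chi_sum)
  qed (rule H)

  moreover have "\<not> classical_design d t H" if t: "h - 1 < t \<and> t \<le> d" for t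
  proof
    assume "classical_design d t H"
    moreover obtain v where v: "v \<in> cube d" "2 * weight d v = d + 1" "\<forall>x\<in>H. v \<bullet> x = 0"
      using ex_dual_codeword[OF M bij] assms(1) unfolding H_eq by auto
    moreover from v(2) d have "weight d v = h" by linarith
    then have "weight d v \<in> {1..t}" using h t unfolding atLeastAtMost_iff by linarith
    ultimately have "(\<Sum>y\<in>H. character d v y) = 0"
      unfolding classical_design_iff by blast
    moreover have "(\<Sum>y\<in>H. character d v y) = (\<Sum>y\<in>H. 1)"
      using v H by (intro sum.cong) (auto simp: character_def)
    moreover have "finite H" using H finite_cube finite_subset by blast
    ultimately show False using H by simp
  qed

  moreover have "graphical_design (cube d) (cube_adj d) d H"
  proof -
    \<comment> \<open>The only frequency that is not integrated is placed at the end of the ordering.\<close>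
    let ?Ev = "eigenvalues (cube d) (cube_adj d)" and ?m = "cube_eigenvalue d h"
    have Ev: "?Ev = cube_eigenvalue d ` {..d}" by (rule eigenvalues_cube[OF d_pos])
    have abs_Ev: "\<bar>cube_eigenvalue d i + 1\<bar> = \<bar>real d - 2 * real i\<bar> / real d" for i
    proof -
      have "cube_eigenvalue d i + 1 = (real d - 2 * real i) / real d"
        using d_pos by (simp add: cube_eigenvalue_def field_simps)
      then show ?thesis by (simp add: abs_divide)
    qed
    have "\<exists>ls. frequency_ordering (cube d) (cube_adj d) (ls @ [?m])"
    proof (rule frequency_ordering_with_last)
      show "finite ?Ev" by (simp add: Ev)
      show "0 \<in> ?Ev" by (auto simp: Ev cube_eigenvalue_def intro!: image_eqI[of _ _ 0])
      show "?m \<in> ?Ev" using h_d by (simp add: Ev)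
      show "?m \<noteq> 0" using h d_pos by (simp add: cube_eigenvalue_def)
      show "\<bar>l + 1\<bar> \<le> 1" if l: "l \<in> ?Ev" for l
      proof -
        obtain i where i: "l = cube_eigenvalue d i" "i \<le> d" using l by (auto simp: Ev)
        then have "\<bar>real d - 2 * real i\<bar> \<le> real d" by linarith
        then show ?thesis unfolding i(1) abs_Ev using d_pos by (simp add: divide_le_eq)
      qed
      show "\<bar>?m + 1\<bar> \<le> \<bar>l + 1\<bar>" if l: "l \<in> ?Ev" for l
      proof -
        obtain i where i: "l = cube_eigenvalue d i" using l by (auto simp: Ev)
        \<comment> \<open>The left-hand side is \<open>1\<close>, and the right-hand side is odd.\<close>
        have "\<bar>int d - 2 * int h\<bar> \<le> \<bar>int d - 2 * int i\<bar>"
          using d by presburger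
        then have "\<bar>real d - 2 * real h\<bar> \<le> \<bar>real d - 2 * real i\<bar>"
          by linarith
        then show ?thesis unfolding i abs_Ev by (rule divide_right_mono) simp
      qed
    qed
    then obtain ls where ls: "frequency_ordering (cube d) (cube_adj d) (ls @ [?m])" by blast
    then have dist: "distinct (ls @ [?m])" and set: "set (ls @ [?m]) = ?Ev"
      unfolding frequency_ordering_def by blast+
    have "card ?Ev = Suc d"
      using d_pos unfolding Ev by (subst card_image) (auto simp: inj_on_def cube_eigenvalue_eq_iff)
    then have len: "length ls = d" using dist set distinct_card[of "ls @ [?m]"] by simp
    have "integrates_eigenspace (cube d) (cube_adj d) H l" if l: "l \<in> set ls" for l
    proof -
      have "l \<in> ?Ev" "l \<noteq> ?m" using l set dist by auto
      then obtain i where i: "l = cube_eigenvalue d i" "i \<noteq> h" by (auto simp: Ev)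
      show ?thesis unfolding i(1)
        by (rule integrates_eigenspace_cube[OF d_pos H]) (use chi_sum i in blast)
    qed
    then show ?thesis using ls len H unfolding graphical_design_def
      by (intro conjI exI[of _ "ls @ [?m]"]) auto
  qed
  ultimately show ?thesis unfolding d_def h_def H_def by blast
qed

end
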